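(* Let $(X,d,\preceq)$ be an ordered metric space, $E$ an O-complete subspace of $X$ and $\ast\in\mathcal{U}_{\iota_n}$. Let $F:X^{n}\to X$ and $g:X\to X$ be two mappings. Suppose that the following conditions (i)-(vi) hold: (i) $F(X^n)\subseteq g(X)\cap E$; (ii) $F$ has the $\iota_n$-mixed $g$-monotone property; (iii) $F$ and $g$ are $(\ast,\mathrm{O})$-compatible; (iv) $g$ is O-continuous; (v) either $F$ is O-continuous or $(E,d,\preceq)$ has the $g$-MCB property; (vi) there exist $x^{(0)}_1,\dots,x^{(0)}_n\in X$ such that either [$g(x^{(0)}_i)\preceq F(x^{(0)}_{i_1},\dots,x^{(0)}_{i_n})$ for each $i\in A$ and $g(x^{(0)}_i)\succeq F(x^{(0)}_{i_1},\dots,x^{(0)}_{i_n})$ for each $i\in B$], or [$g(x^{(0)}_i)\succeq F(x^{(0)}_{i_1},\dots,x^{(0)}_{i_n})$ for each $i\in A$ and $g(x^{(0)}_i)\preceq F(x^{(0)}_{i_1},\dots,x^{(0)}_{i_n})$ for each $i\in B$]. Suppose moreover that at least one of the following two conditions holds: (vii) there exists $\varphi\in\Omega$ such that $$\frac1n\sum_{i=1}^n d\big(F(x_{i_1},\dots,x_{i_n}),F(y_{i_1},\dots,y_{i_n})\big)\le\varphi\Big(\frac1n\sum_{i=1}^n d(gx_i,gy_i)\Big)$$ for all $x_1,\dots,x_n,y_1,\dots,y_n\in X$ such that $(gx_1,\dots,gx_n)$ and $(gy_1,\dots,gy_n)$ are comparable with respect to $\sqsubseteq_{\iota_n}$; (vii$'$)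 there exists $\varphi\in\Omega$ such that $$\max_{i\in I_n} d\big(F(x_{i_1},\dots,x_{i_n}),F(y_{i_1},\dots,y_{i_n})\big)\le\varphi\Big(\max_{i\in I_n} d(gx_i,gy_i)\Big)$$ for all $x_1,\dots,x_n,y_1,\dots,y_n\in X$ such that $(gx_1,\dots,gx_n)$ and $(gy_1,\dots,gy_n)$ are comparable with respect to $\sqsubseteq_{\iota_n}$. Suppose in addition that for every pair $(x_1,\dots,x_n),(y_1,\dots,y_n)\in X^n$ there exists $(z_1,\dots,z_n)\in X^n$ such that $(gz_1,\dots,gz_n)$ is comparable to both $(gx_1,\dots,gx_n)$ and $(gy_1,\dots,gy_n)$ with respect to $\sqsubseteq_{\iota_n}$, and that $g$ is one-one. Then $F$ and $g$ have a unique $\ast$-coincidence point.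
   Context: Fix an integer $n\ge 2$, put $I_n=\{1,\dots,n\}$, and let $\iota_n=\{A,B\}$ be a fixed partition of $I_n$ into two nonempty disjoint subsets $A,B$. For a binary operation $\ast:I_n\times I_n\to I_n$ write $i_k:=\ast(i,k)$. $\mathcal{U}_{\iota_n}$ is the set of all binary operations $\ast$ on $I_n$ with $\ast(A\times A)\subseteq A$, $\ast(A\times B)\subseteq B$, $\ast(B\times A)\subseteq B$, $\ast(B\times B)\subseteq A$. We write $gx$ for $g(x)$. An ordered metric space $(X,d,\preceq)$ is a nonempty set $X$ with a metric $d$ and a partial order $\preceq$; $x\succeq y$ means $y\preceq x$. On $X^n$, $(x_1,\dots,x_n)\sqsubseteq_{\iota_n}(y_1,\dots,y_n)$ means $x_i\preceq y_i$ for each $i\in A$ and $x_i\succeq y_i$ for each $i\in B$. Two elements of a partially ordered set are comparable if one is less than or equal to the other. A subspace is a nonempty subset with the restricted metric and order. Sequences are indexed by $m\in\mathbb{N}_0=\{0,1,2,\dots\}$. A sequence is increasing (decreasing) if $x^{(m)}\preceq x^{(l)}$ ($x^{(m)}\succeq x^{(l)}$) whenever $m<l$, and monotone if it is increasing or decreasing. $x^{(m)}\uparrow x$ (resp. $\downarrow x$, $\uparrow\downarrow x$) means $\{x^{(m)}\}$ is increasing (resp. decreasing, monotone) and converges to $x$ in $d$. An ordered metric space is O-complete if every monotone Cauchy sequence in it converges in it. $F:X^n\to X$ has the $\iota_n$-mixed $g$-monotone property if, with all other arguments fixed arbitrarily, $g(\underline{x}_i)\preceq g(\overline{x}_i)$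 implies $F(\dots,\underline{x}_i,\dots)\preceq F(\dots,\overline{x}_i,\dots)$ ($i$-th argument) when $i\in A$, and $F(\dots,\underline{x}_i,\dots)\succeq F(\dots,\overline{x}_i,\dots)$ when $i\in B$. $F$ and $g$ are $(\ast,\mathrm{O})$-compatible if for all sequences $\{x_1^{(m)}\},\dots,\{x_n^{(m)}\}$ in $X$ and all $z_1,\dots,z_n\in X$: if $g(x_i^{(m)})\uparrow\downarrow z_i$ and $F(x_{i_1}^{(m)},\dots,x_{i_n}^{(m)})\uparrow\downarrow z_i$ for each $i\in I_n$, then $\lim_{m\to\infty} d\big(gF(x_{i_1}^{(m)},\dots,x_{i_n}^{(m)}),F(gx_{i_1}^{(m)},\dots,gx_{i_n}^{(m)})\big)=0$ for each $i\in I_n$. $g$ is O-continuous if $x^{(m)}\uparrow\downarrow x$ implies $g(x^{(m)})\to g(x)$. $F$ is O-continuous if $x_i^{(m)}\uparrow\downarrow x_i$ for all $i\in I_n$ implies $F(x_1^{(m)},\dots,x_n^{(m)})\to F(x_1,\dots,x_n)$. $(E,d,\preceq)$ has the $g$-MCB property if for every sequence $\{x^{(m)}\}$ in $E$ and $x\in E$: $x^{(m)}\uparrow x$ implies $g(x^{(m)})\preceq g(x)$ for all $m$, and $x^{(m)}\downarrow x$ implies $g(x^{(m)})\succeq g(x)$ for all $m$. $\Omega$ is the set of functions $\varphi:[0,\infty)\to[0,\infty)$ with $\varphi(t)<t$ and $\limsup_{r\to t^+}\varphi(r)<t$ for every $t>0$. An $\ast$-coincidence point of $F$ and $g$ is $(x_1,\dots,x_n)\in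 X^n$ with $F(x_{i_1},\dots,x_{i_n})=g(x_i)$ for each $i\in I_n$. *)

theory Defs
  imports "HOL-Analysis.Analysis"
begin

text \<open>
  An ordered metric space is a type of class \<open>metric_space\<close> and \<open>order\<close>; the index set
  \<open>I\<^sub>n\<close> is a finite type \<open>'n\<close>, so that \<open>X\<^sup>n\<close> becomes \<open>'a ^ 'n\<close>. The library's componentwise order
  and Euclidean metric on \<open>'a ^ 'n\<close> are not used.
\<close>

definition index_partition :: "'n set \<Rightarrow> 'n set \<Rightarrow> bool" where
  "index_partition A B \<longleftrightarrow> A \<noteq> {} \<and> B \<noteq> {} \<and> A \<inter> B = {} \<and> A \<union> B = UNIV"

definition mixed_ops :: "'n set \<Rightarrow> 'n set \<Rightarrow> ('n \<Rightarrow> 'n \<Rightarrow> 'n) set" where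
  "mixed_ops A B = {star.
     (\<forall>i\<in>A. \<forall>k\<in>A. star i k \<in> A) \<and> (\<forall>i\<in>A. \<forall>k\<in>B. star i k \<in> B) \<and>
     (\<forall>i\<in>B. \<forall>k\<in>A. star i k \<in> B) \<and> (\<forall>i\<in>B. \<forall>k\<in>B. star i k \<in> A)}"

text \<open>The tuple \<open>(x\<^bsub>i\<^sub>1\<^esub>, \<dots>, x\<^bsub>i\<^sub>n\<^esub>)\<close>, where \<open>i\<^sub>k = star i k\<close>.\<close>

definition star_tuple :: "('n \<Rightarrow> 'n \<Rightarrow> 'n) \<Rightarrow> 'a ^ 'n \<Rightarrow> 'n \<Rightarrow> 'a ^ 'n" where
  "star_tuple star x i = (\<chi> k. x $ star i k)"

definition map_tuple :: "('a \<Rightarrow> 'a) \<Rightarrow> 'a ^ 'n \<Rightarrow> 'a ^ 'n" where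
  "map_tuple g x = (\<chi> i. g (x $ i))"

definition mixed_le :: "'n set \<Rightarrow> 'n set \<Rightarrow> ('a::order) ^ 'n \<Rightarrow> 'a ^ 'n \<Rightarrow> bool" where
  "mixed_le A B x y \<longleftrightarrow> (\<forall>i\<in>A. x $ i \<le> y $ i) \<and> (\<forall>i\<in>B. x $ i \<ge> y $ i)"

definition mixed_comparable :: "'n set \<Rightarrow> 'n set \<Rightarrow> ('a::order) ^ 'n \<Rightarrow> 'a ^ 'n \<Rightarrow> bool" where
  "mixed_comparable A B x y \<longleftrightarrow> mixed_le A B x y \<or> mixed_le A B y x"

definition mono_tendsto :: "(nat \<Rightarrow> 'a::{metric_space, order}) \<Rightarrow> 'a \<Rightarrow> bool" where
  "mono_tendsto X x \<longleftrightarrow> monoseq X \<and> X \<longlonglongrightarrow> x"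

definition O_complete :: "('a::{metric_space, order}) set \<Rightarrow> bool" where
  "O_complete E \<longleftrightarrow>
     (\<forall>X. (\<forall>m. X m \<in> E) \<and> monoseq X \<and> Cauchy X \<longrightarrow> (\<exists>x\<in>E. X \<longlonglongrightarrow> x))"

definition replace_arg :: "'a ^ 'n \<Rightarrow> 'n \<Rightarrow> 'a \<Rightarrow> 'a ^ 'n" where
  "replace_arg x i u = (\<chi> j. if j = i then u else x $ j)"

definition mixed_monotone ::
  "'n set \<Rightarrow> 'n set \<Rightarrow> (('a::order) ^ 'n \<Rightarrow> 'a) \<Rightarrow> ('a \<Rightarrow> 'a) \<Rightarrow> bool" where
  "mixed_monotone A B F g \<longleftrightarrow>
     (\<forall>x u v. g u \<le> g v \<longrightarrow>
        (\<forall>i\<in>A. F (replace_arg x i u) \<le> F (replace_arg x i v)) \<and>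
        (\<forall>i\<in>B. F (replace_arg x i u) \<ge> F (replace_arg x i v)))"

definition O_compatible ::
  "('n \<Rightarrow> 'n \<Rightarrow> 'n) \<Rightarrow> (('a::{metric_space, order}) ^ 'n \<Rightarrow> 'a) \<Rightarrow> ('a \<Rightarrow> 'a) \<Rightarrow> bool" where
  "O_compatible star F g \<longleftrightarrow>
     (\<forall>(X :: nat \<Rightarrow> 'a ^ 'n) (z :: 'a ^ 'n).
        (\<forall>i. mono_tendsto (\<lambda>m. g (X m $ i)) (z $ i) \<and>
             mono_tendsto (\<lambda>m. F (star_tuple star (X m) i)) (z $ i)) \<longrightarrow>
        (\<forall>i. (\<lambda>m. dist (g (F (star_tuple star (X m) i)))
                        (F (map_tuple g (star_tuple star (X m) i)))) \<longlonglongrightarrow> 0))"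

definition O_continuous :: "('a::{metric_space, order} \<Rightarrow> 'a) \<Rightarrow> bool" where
  "O_continuous g \<longleftrightarrow> (\<forall>X x. mono_tendsto X x \<longrightarrow> (\<lambda>m. g (X m)) \<longlonglongrightarrow> g x)"

definition O_continuous_tuple :: "(('a::{metric_space, order}) ^ 'n \<Rightarrow> 'a) \<Rightarrow> bool" where
  "O_continuous_tuple F \<longleftrightarrow>
     (\<forall>(X :: nat \<Rightarrow> 'a ^ 'n) x. (\<forall>i. mono_tendsto (\<lambda>m. X m $ i) (x $ i)) \<longrightarrow>
        (\<lambda>m. F (X m)) \<longlonglongrightarrow> F x)"

definition MCB :: "('a::{metric_space, order} \<Rightarrow> 'a) \<Rightarrow> 'a set \<Rightarrow> bool" where
  "MCB g E \<longleftrightarrow>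
     (\<forall>X. \<forall>x\<in>E. (\<forall>m. X m \<in> E) \<longrightarrow>
        (incseq X \<and> X \<longlonglongrightarrow> x \<longrightarrow> (\<forall>m. g (X m) \<le> g x)) \<and>
        (decseq X \<and> X \<longlonglongrightarrow> x \<longrightarrow> (\<forall>m. g (X m) \<ge> g x)))"

text \<open>
  Maps \<open>[0,\<infinity>) \<Rightarrow> [0,\<infinity>)\<close> are represented by functions on \<open>real\<close> whose values at negative arguments
  are unconstrained. The upper limit is taken in the extended reals, where it always exists;
  the filter \<open>at_right t\<close> excludes the point \<open>t\<close> itself.
\<close>

definition Omega :: "(real \<Rightarrow> real) set" where
  "Omega = {\<phi>. (\<forall>t\<ge>0. \<phi> t \<ge> 0) \<and>
     (\<forall>t>0. \<phi> t < t \<and> Limsup (at_right t) (\<lambda>r. ereal (\<phi> r)) < ereal t)}"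

definition coincidence_point ::
  "('n \<Rightarrow> 'n \<Rightarrow> 'n) \<Rightarrow> ('a ^ 'n \<Rightarrow> 'a) \<Rightarrow> ('a \<Rightarrow> 'a) \<Rightarrow> 'a ^ 'n \<Rightarrow> bool" where
  "coincidence_point star F g x \<longleftrightarrow> (\<forall>i. F (star_tuple star x i) = g (x $ i))"

end

theory Submission
  imports Defs
begin

text \<open>
  On the product, \<open>F\<close> becomes the self-map \<open>T\<close> with components \<open>F (x\<^bsub>i\<^sub>1\<^esub>, \<dots>, x\<^bsub>i\<^sub>n\<^esub>)\<close> and \<open>g\<close> acts
  componentwise as \<open>G\<close>; the mixed monotone property and \<open>\<ast> \<in> \<U>\<close> make \<open>T\<close> monotone relative
  to \<open>G\<close> for the mixed order. Both contraction conditions say that \<open>T\<close> contracts relative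
  to \<open>G\<close> for a metric \<open>D\<close> on the product (mean or maximum), and all that is needed of \<open>\<phi>\<close> is the
  Meir--Keeler condition: for every \<open>\<epsilon> > 0\<close> there is \<open>\<delta> > 0\<close> such that
  \<open>D (G x) (G y) < \<epsilon> + \<delta>\<close> forces \<open>D (T x) (T y) < \<epsilon>\<close>. The iteration \<open>G x\<^sub>m\<^sub>+\<^sub>1 = T x\<^sub>m\<close> is then Cauchy
  along a chain, and its limit is a coincidence point by compatibility. An iteration started from
  a tuple comparable to two coincidence points converges to the \<open>G\<close>-images of both.
\<close>

section \<open>The Meir--Keeler condition\<close>

text \<open>The strict bound on the upper limit at \<open>\<epsilon>\<close> keeps
  \<open>\<phi>\<close> below \<open>\<epsilon>\<close> on some interval to its right; for
  \<open>0 < r\<close> up to \<open>\<epsilon>\<close> itself, \<open>\<phi> r < r\<close> suffices.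
  The point 0 is left out because membership in \<open>Omega\<close> allows \<open>\<phi> 0\<close>
  to be positive.\<close>

lemma Omega_Meir_Keeler:
  assumes "\<phi> \<in> Omega" "\<epsilon> > 0"
  obtains \<delta> where "\<delta> > 0" "\<And>r. 0 < r \<Longrightarrow> r < \<epsilon> + \<delta> \<Longrightarrow> \<phi> r < \<epsilon>"
proof -
  have lt: "\<phi> t < t" and lim: "Limsup (at_right t) (\<lambda>r. ereal (\<phi> r)) < ereal t" if "t > 0" for t
    using assms that by (auto simp: Omega_def)
  have "eventually (\<lambda>r. ereal (\<phi> r) < ereal \<epsilon>) (at_right \<epsilon>)"
    by (rule Limsup_lessD[OF lim[OF assms(2)]])
  then obtain b where b: "b > \<epsilon>" "\<And>r. \<epsilon> < r \<Longrightarrow> r < b \<Longrightarrow> \<phi> r < \<epsilon>"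
    by (auto simp: eventually_at_right_field)
  show ?thesis
  proof
    show "b - \<epsilon> > 0" using b by simp
    fix r assume r: "0 < r" "r < \<epsilon> + (b - \<epsilon>)"
    show "\<phi> r < \<epsilon>"
      using b(2)[of r] lt[of r] r by linarith
  qed
qed

lemma Meir_Keeler_tendsto_0:
  fixes d :: "nat \<Rightarrow> real"
  assumes nonneg: "\<And>m. 0 \<le> d m"
    and MK: "\<And>\<epsilon>. \<epsilon> > 0 \<Longrightarrow> \<exists>\<delta>>0. \<forall>m. d m < \<epsilon> + \<delta> \<longrightarrow> d (Suc m) < \<epsilon>"
  shows "d \<longlonglongrightarrow> 0"
proof -
  have "d (Suc m) \<le> d m" for m
  proof (rule ccontr)
    assume less: "\<not> d (Suc m) \<le> d m"
    then have "d (Suc m) > 0" using nonneg[of m] by linarith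
    \<comment> \<open>Applied with \<open>d (Suc m)\<close> itself as the threshold, the condition
      would give \<open>d (Suc m) < d (Suc m)\<close>.\<close>
    from MK[OF this] less show False
      by (metis add_strict_mono add.right_neutral less_irrefl not_le)
  qed
  then have dec: "decseq d" by (rule decseq_SucI)
  obtain L where L: "d \<longlonglongrightarrow> L" and le: "\<And>m. L \<le> d m"
    using decseq_convergent[OF dec, of 0] nonneg by blast
  have "L \<ge> 0" using L nonneg by (intro LIMSEQ_le_const) auto
  moreover have "\<not> L > 0"
  proof
    assume "L > 0"
    \<comment> \<open>A positive limit is impossible: once \<open>d m\<close> is within
      \<open>\<delta>\<close> of \<open>L\<close>, the next term drops below \<open>L\<close>, which
      bounds the decreasing sequence from below.\<close>
    from MK[OF this] obtain \<delta> where \<delta>: "\<delta> > 0" "\<And>m. d m < L + \<delta> \<Longrightarrow> d (Suc m) < L" by blast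
    have "eventually (\<lambda>m. d m < L + \<delta>) sequentially"
      by (rule order_tendstoD(2)[OF L]) (use \<delta> in simp)
    then obtain m where "d m < L + \<delta>" by (auto simp: eventually_sequentially)
    from \<delta>(2)[OF this] le[of "Suc m"] show False by simp
  qed
  ultimately show ?thesis using L by (simp add: order_antisym_conv)
qed

text \<open>Consecutive distances tend to 0. From a late index on, all further points stay within
  \<open>\<epsilon> / 2 + \<delta>\<close>: the condition brings the shifted pair within
  \<open>\<epsilon> / 2\<close>, and the first step costs less than \<open>\<delta>\<close>, so the
  bound reproduces itself.\<close>

lemma Meir_Keeler_Cauchy:
  fixes D :: "'b \<Rightarrow> 'b \<Rightarrow> real" and a :: "nat \<Rightarrow> 'b"
  assumes nonneg: "\<And>x y. 0 \<le> D x y" and refl: "\<And>x. D x x = 0"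
    and triangle: "\<And>x y z. D x z \<le> D x y + D y z"
    and MK: "\<And>\<epsilon>. \<epsilon> > 0 \<Longrightarrow>
      \<exists>\<delta>>0. \<forall>m l. m \<le> l \<longrightarrow> D (a m) (a l) < \<epsilon> + \<delta> \<longrightarrow> D (a (Suc m)) (a (Suc l)) < \<epsilon>"
    and "\<epsilon> > 0"
  shows "\<exists>N. \<forall>m\<ge>N. \<forall>l\<ge>m. D (a m) (a l) < \<epsilon>"
proof -
  have step0: "(\<lambda>m. D (a m) (a (Suc m))) \<longlonglongrightarrow> 0"
  proof (rule Meir_Keeler_tendsto_0[OF nonneg])
    fix \<epsilon> :: real assume "\<epsilon> > 0"
    from MK[OF this] show
      "\<exists>\<delta>>0. \<forall>m. D (a m) (a (Suc m)) < \<epsilon> + \<delta> \<longrightarrow> D (a (Suc m)) (a (Suc (Suc m))) < \<epsilon>"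
      by (meson le_SucI order_refl)
  qed
  have half: "\<epsilon> / 2 > 0" using \<open>\<epsilon> > 0\<close> by simp
  from MK[OF half] obtain \<delta>' where \<delta>': "\<delta>' > 0"
    "\<And>m l. m \<le> l \<Longrightarrow> D (a m) (a l) < \<epsilon> / 2 + \<delta>' \<Longrightarrow> D (a (Suc m)) (a (Suc l)) < \<epsilon> / 2"
    by blast
  \<comment> \<open>The cap \<open>\<delta>'\<close> keeps the condition applicable in the
    induction; the cap \<open>\<epsilon> / 2\<close> makes the final bound at most
    \<open>\<epsilon>\<close>.\<close>
  define \<delta> where "\<delta> = min \<delta>' (\<epsilon> / 2)"
  have \<delta>: "\<delta> > 0" "\<delta> \<le> \<delta>'" "\<delta> \<le> \<epsilon> / 2" using \<delta>' half by (auto simp: \<delta>_def)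
  obtain N where N: "\<And>m. m \<ge> N \<Longrightarrow> D (a m) (a (Suc m)) < \<delta>"
    using order_tendstoD(2)[OF step0 \<delta>(1)] by (auto simp: eventually_sequentially)
  have close: "D (a m) (a (m + k)) < \<epsilon> / 2 + \<delta>" if "m \<ge> N" for m k
  proof (induction k)
    case 0
    then show ?case using half \<delta> refl by simp
  next
    case (Suc k)
    have "D (a (Suc m)) (a (Suc (m + k))) < \<epsilon> / 2"
      using \<delta>'(2)[of m "m + k"] Suc \<delta> by simp
    then show ?case
      using triangle[of "a m" "a (Suc (m + k))" "a (Suc m)"] N[OF that] by simp
  qed
  have "D (a m) (a l) < \<epsilon>" if "m \<ge> N" "l \<ge> m" for m l
    using close[OF that(1), of "l - m"] that \<delta> by simp
  then show ?thesis by blast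
qed

section \<open>Mixed monotone maps on tuples\<close>

definition star_map :: "('n \<Rightarrow> 'n \<Rightarrow> 'n) \<Rightarrow> ('a ^ 'n \<Rightarrow> 'a) \<Rightarrow> 'a ^ 'n \<Rightarrow> 'a ^ 'n" where
  "star_map star F x = (\<chi> i. F (star_tuple star x i))"

lemma star_map_nth [simp]: "star_map star F x $ i = F (star_tuple star x i)"
  by (simp add: star_map_def)

lemma star_tuple_nth [simp]: "star_tuple star x i $ k = x $ star i k"
  by (simp add: star_tuple_def)

lemma map_tuple_nth [simp]: "map_tuple g x $ i = g (x $ i)"
  by (simp add: map_tuple_def)

lemma coincidence_point_iff: "coincidence_point star F g x \<longleftrightarrow> star_map star F x = map_tuple g x"
  by (simp add: coincidence_point_def vec_eq_iff)

lemma map_tuple_star_tuple: "map_tuple g (star_tuple star x i) = star_tuple star (map_tuple g x) i"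
  by (simp add: vec_eq_iff)

lemma mixed_chain_iff:
  "(\<forall>m. mixed_le A B (a m) (a (Suc m))) \<longleftrightarrow>
     (\<forall>i\<in>A. incseq (\<lambda>m. a m $ i)) \<and> (\<forall>i\<in>B. decseq (\<lambda>m. a m $ i))"
  by (auto simp: mixed_le_def incseq_Suc_iff decseq_Suc_iff)

text \<open>Exchanging the two index sets turns a decreasing chain into an increasing one, so
  \<open>mixed_chain_iff\<close> serves both directions.\<close>

lemma mixed_le_swap: "mixed_le A B x y \<longleftrightarrow> mixed_le B A y x"
  by (auto simp: mixed_le_def)

text \<open>The entries of \<open>x\<close> are replaced by those of \<open>y\<close> one at a time,
  with \<open>S\<close> the set of positions already replaced. Each replacement can only raise
  \<open>F\<close>: arguments in \<open>A\<close> go up where \<open>F\<close> is increasing,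
  arguments in \<open>B\<close> go down where it is decreasing.\<close>

lemma mixed_monotone_le:
  fixes F :: "('a::order) ^ 'n::finite \<Rightarrow> 'a"
  assumes AB: "A \<union> B = UNIV" and F: "mixed_monotone A B F g"
    and le: "mixed_le A B (map_tuple g x) (map_tuple g y)"
  shows "F x \<le> F y"
proof -
  have "F x \<le> F (\<chi> k. if k \<in> S then y $ k else x $ k)" for S :: "'n set"
  proof (induction S rule: finite_induct[OF finite])
    case 1
    then show ?case by simp
  next
    case (2 k S)
    let ?w = "\<chi> j. if j \<in> S then y $ j else x $ j"
    \<comment> \<open>As \<open>k\<close> is not in \<open>S\<close>, the hybrid tuple still has the
      entry of \<open>x\<close> there, so both stages are replacements in one tuple.\<close>
    have w: "replace_arg ?w k (x $ k) = ?w"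
      "replace_arg ?w k (y $ k) = (\<chi> j. if j \<in> insert k S then y $ j else x $ j)"
      using 2 by (auto simp: replace_arg_def vec_eq_iff)
    have "F (replace_arg ?w k (x $ k)) \<le> F (replace_arg ?w k (y $ k))"
    proof (cases "k \<in> A")
      case True
      then show ?thesis using F le by (auto simp: mixed_monotone_def mixed_le_def)
    next
      case False
      then have "k \<in> B" using AB by blast
      then show ?thesis using F le by (auto simp: mixed_monotone_def mixed_le_def)
    qed
    then show ?case using 2 unfolding w by (meson order_trans)
  qed
  from this[of UNIV] show ?thesis by simp
qed

text \<open>For \<open>i\<close> in \<open>A\<close>, \<open>star i\<close> preserves the two
  blocks, and the reindexed tuples keep their order. For \<open>i\<close> in \<open>B\<close> it
  exchanges the blocks, and the order is reversed, as the mixed order demands at such a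
  component.\<close>

lemma star_map_mono:
  fixes F :: "('a::order) ^ 'n::finite \<Rightarrow> 'a"
  assumes AB: "A \<union> B = UNIV" and star: "star \<in> mixed_ops A B" and F: "mixed_monotone A B F g"
    and le: "mixed_le A B (map_tuple g x) (map_tuple g y)"
  shows "mixed_le A B (star_map star F x) (star_map star F y)"
proof -
  have "mixed_le A B (map_tuple g (star_tuple star x i)) (map_tuple g (star_tuple star y i))"
    if "i \<in> A" for i
    using le star that by (auto simp: mixed_le_def mixed_ops_def)
  moreover have "mixed_le A B (map_tuple g (star_tuple star y i)) (map_tuple g (star_tuple star x i))"
    if "i \<in> B" for i
    using le star that by (auto simp: mixed_le_def mixed_ops_def)
  ultimately show ?thesis
    using mixed_monotone_le[OF AB F] by (simp add: mixed_le_def)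
qed

section \<open>Metrics on tuples\<close>

text \<open>A common interface for the mean and the maximum of the componentwise distances. The
  factor \<open>CARD('n)\<close> is forced by the mean, which can be that many times smaller than a
  single component.\<close>

definition tuple_metric :: "('a::metric_space ^ 'n::finite \<Rightarrow> 'a ^ 'n \<Rightarrow> real) \<Rightarrow> bool" where
  "tuple_metric D \<longleftrightarrow>
     (\<forall>x y z. D x z \<le> D x y + D y z) \<and>
     (\<forall>x y i. dist (x $ i) (y $ i) \<le> real CARD('n) * D x y) \<and>
     (\<forall>x y. D x y \<le> (\<Sum>i\<in>UNIV. dist (x $ i) (y $ i)))"

lemma tuple_metric_mean:
  "tuple_metric (\<lambda>x y :: 'a::metric_space ^ 'n::finite.
     1 / real CARD('n) * (\<Sum>i\<in>UNIV. dist (x $ i) (y $ i)))"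
  unfolding tuple_metric_def
proof (intro conjI allI)
  fix x y z :: "'a ^ 'n" and i :: 'n
  have "(\<Sum>i\<in>UNIV. dist (x $ i) (z $ i)) \<le> (\<Sum>i\<in>UNIV. dist (x $ i) (y $ i) + dist (y $ i) (z $ i))"
    by (intro sum_mono dist_triangle)
  then show "1 / real CARD('n) * (\<Sum>i\<in>UNIV. dist (x $ i) (z $ i))
      \<le> 1 / real CARD('n) * (\<Sum>i\<in>UNIV. dist (x $ i) (y $ i))
        + 1 / real CARD('n) * (\<Sum>i\<in>UNIV. dist (y $ i) (z $ i))"
    by (simp add: sum.distrib divide_right_mono flip: add_divide_distrib)
  show "dist (x $ i) (y $ i)
      \<le> real CARD('n) * (1 / real CARD('n) * (\<Sum>i\<in>UNIV. dist (x $ i) (y $ i)))"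
    by (simp add: member_le_sum[of i UNIV "\<lambda>i. dist (x $ i) (y $ i)"])
  have "real CARD('n) \<ge> 1" by (simp add: Suc_le_eq)
  then show "1 / real CARD('n) * (\<Sum>i\<in>UNIV. dist (x $ i) (y $ i)) \<le> (\<Sum>i\<in>UNIV. dist (x $ i) (y $ i))"
    by (intro mult_left_le_one_le sum_nonneg) auto
qed

lemma tuple_metric_max:
  "tuple_metric (\<lambda>x y :: 'a::metric_space ^ 'n::finite. MAX i\<in>UNIV. dist (x $ i) (y $ i))"
  unfolding tuple_metric_def
proof (intro conjI allI)
  fix x y z :: "'a ^ 'n" and i :: 'n
  have le_Max: "dist (u $ j) (v $ j) \<le> (MAX i\<in>UNIV. dist (u $ i) (v $ i))" for u v :: "'a ^ 'n" and j
    by (intro Max_ge) auto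
  show "(MAX i\<in>UNIV. dist (x $ i) (z $ i))
      \<le> (MAX i\<in>UNIV. dist (x $ i) (y $ i)) + (MAX i\<in>UNIV. dist (y $ i) (z $ i))"
    by (intro Max.boundedI) (auto intro!: order_trans[OF dist_triangle add_mono] le_Max)
  have "real CARD('n) \<ge> 1" by (simp add: Suc_le_eq)
  moreover have "(MAX i\<in>UNIV. dist (x $ i) (y $ i)) \<ge> 0"
    using le_Max[of x i y] zero_le_dist order_trans by blast
  ultimately show "dist (x $ i) (y $ i) \<le> real CARD('n) * (MAX i\<in>UNIV. dist (x $ i) (y $ i))"
    using le_Max[of x i y] mult_right_mono[of 1 "real CARD('n)"] by fastforce
  show "(MAX i\<in>UNIV. dist (x $ i) (y $ i)) \<le> (\<Sum>i\<in>UNIV. dist (x $ i) (y $ i))"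
    by (intro Max.boundedI) (auto intro!: member_le_sum)
qed

text \<open>This turns compatibility, a statement about vanishing distances, into
  convergence.\<close>

lemma tendsto_dist_0_transform:
  fixes f h :: "'b \<Rightarrow> 'c::metric_space"
  assumes "(f \<longlongrightarrow> l) \<F>" "((\<lambda>x. dist (f x) (h x)) \<longlongrightarrow> 0) \<F>"
  shows "(h \<longlongrightarrow> l) \<F>"
proof -
  have "((\<lambda>x. dist (f x) (h x) + dist (f x) l) \<longlongrightarrow> 0) \<F>"
    using tendsto_add[OF assms(2) assms(1)[unfolded tendsto_dist_iff[of f]]] by simp
  then have "((\<lambda>x. dist (h x) l) \<longlongrightarrow> 0) \<F>"
    by (rule tendsto_sandwich[OF _ _ tendsto_const, rotated 2])
      (auto intro!: always_eventually dist_triangle3)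
  then show ?thesis by (subst tendsto_dist_iff)
qed

context
  fixes D :: "'a::metric_space ^ 'n::finite \<Rightarrow> 'a ^ 'n \<Rightarrow> real"
  assumes D: "tuple_metric D"
begin

lemma tuple_metric_triangle: "D x z \<le> D x y + D y z"
  using D by (simp add: tuple_metric_def)

lemma tuple_metric_component: "dist (x $ i) (y $ i) \<le> real CARD('n) * D x y"
  using D by (simp add: tuple_metric_def)

lemma tuple_metric_nonneg: "0 \<le> D x y"
proof -
  have "0 \<le> real CARD('n) * D x y"
    by (rule order_trans[OF zero_le_dist tuple_metric_component])
  then show ?thesis by (simp add: zero_le_mult_iff)
qed

lemma tuple_metric_le_sum: "D x y \<le> (\<Sum>i\<in>UNIV. dist (x $ i) (y $ i))"
  using D by (simp add: tuple_metric_def)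

lemma tuple_metric_refl: "D x x = 0"
  using tuple_metric_le_sum[of x x] tuple_metric_nonneg[of x x] by simp

lemma tuple_metric_eq_0: "D x y = 0 \<Longrightarrow> x = y"
  using tuple_metric_component[of x _ y] by (simp add: vec_eq_iff)

lemma tuple_metric_tendsto_componentI:
  assumes "(\<lambda>m. D (a m) z) \<longlonglongrightarrow> 0"
  shows "(\<lambda>m. a m $ i) \<longlonglongrightarrow> z $ i"
proof -
  have "(\<lambda>m. real CARD('n) * D (a m) z) \<longlonglongrightarrow> 0"
    using tendsto_mult_left[OF assms, of "real CARD('n)"] by simp
  then have "(\<lambda>m. dist (a m $ i) (z $ i)) \<longlonglongrightarrow> 0"
    by (rule tendsto_sandwich[OF _ _ tendsto_const, rotated 2])
      (auto intro!: always_eventually tuple_metric_component)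
  then show ?thesis by (subst tendsto_dist_iff)
qed

lemma tuple_metric_tendstoI:
  assumes "\<And>i. (\<lambda>m. a m $ i) \<longlonglongrightarrow> z $ i"
  shows "(\<lambda>m. D (a m) z) \<longlonglongrightarrow> 0"
proof (rule tendsto_sandwich[of "\<lambda>_. 0" _ _ "\<lambda>m. \<Sum>i\<in>UNIV. dist (a m $ i) (z $ i)"])
  have "(\<lambda>m. \<Sum>i\<in>UNIV. dist (a m $ i) (z $ i)) \<longlonglongrightarrow> (\<Sum>i\<in>(UNIV :: 'n set). 0)"
    using assms unfolding tendsto_dist_iff[of _ "z $ _"] by (rule tendsto_sum)
  then show "(\<lambda>m. \<Sum>i\<in>UNIV. dist (a m $ i) (z $ i)) \<longlonglongrightarrow> 0" by simp
qed (auto simp: tuple_metric_nonneg tuple_metric_le_sum)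

lemma tuple_metric_Cauchy_componentI:
  assumes "\<And>\<epsilon>. \<epsilon> > 0 \<Longrightarrow> \<exists>N. \<forall>m\<ge>N. \<forall>l\<ge>m. D (a m) (a l) < \<epsilon>"
  shows "Cauchy (\<lambda>m. a m $ i)"
  unfolding Cauchy_altdef
proof (intro allI impI)
  fix \<epsilon> :: real assume "\<epsilon> > 0"
  then obtain N where N: "\<And>m l. m \<ge> N \<Longrightarrow> l \<ge> m \<Longrightarrow> D (a m) (a l) < \<epsilon> / real CARD('n)"
    using assms[of "\<epsilon> / real CARD('n)"] by auto
  have "dist (a m $ i) (a l $ i) < \<epsilon>" if "m \<ge> N" "l > m" for m l
    using tuple_metric_component[of "a m" i "a l"] N[of m l] that
    by (simp add: pos_less_divide_eq mult.commute)
  then show "\<exists>M. \<forall>m\<ge>M. \<forall>n>m. dist (a m $ i) (a n $ i) < \<epsilon>" by blast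
qed

end

section \<open>Coincidence points of Meir--Keeler maps\<close>

text \<open>This setting suffices for iteration and for uniqueness of \<open>G\<close>-images;
  completeness, compatibility and continuity enter only with existence.\<close>

locale mixed_Meir_Keeler =
  fixes A B :: "'n::finite set"
    and star :: "'n \<Rightarrow> 'n \<Rightarrow> 'n"
    and F :: "('a::{metric_space, order}) ^ 'n \<Rightarrow> 'a"
    and g :: "'a \<Rightarrow> 'a"
    and D :: "'a ^ 'n \<Rightarrow> 'a ^ 'n \<Rightarrow> real"
  assumes AB: "A \<union> B = UNIV"
    and star: "star \<in> mixed_ops A B"
    and range_F: "range F \<subseteq> range g"
    and F_mono: "mixed_monotone A B F g"
    and D: "tuple_metric D"
    and Meir_Keeler: "\<epsilon> > 0 \<Longrightarrow> \<exists>\<delta>>0. \<forall>x y.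
      mixed_comparable A B (map_tuple g x) (map_tuple g y) \<longrightarrow>
      D (map_tuple g x) (map_tuple g y) < \<epsilon> + \<delta> \<longrightarrow>
      D (star_map star F x) (star_map star F y) < \<epsilon>"
begin

abbreviation "T \<equiv> star_map star F"
abbreviation "G \<equiv> map_tuple g"

lemma T_mono: "mixed_le A B (G x) (G y) \<Longrightarrow> mixed_le A B (T x) (T y)"
  by (rule star_map_mono[OF AB star F_mono])

lemma T_comparable: "mixed_comparable A B (G x) (G y) \<Longrightarrow> mixed_comparable A B (T x) (T y)"
  using T_mono by (auto simp: mixed_comparable_def)

text \<open>If the distance grew, the Meir-Keeler condition at \<open>D (T x) (T y)\<close> would
  give a strict self-inequality.\<close>

lemma T_nonexpansive:
  assumes "mixed_comparable A B (G x) (G y)"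
  shows "D (T x) (T y) \<le> D (G x) (G y)"
proof (rule ccontr)
  assume less: "\<not> D (T x) (T y) \<le> D (G x) (G y)"
  then have "D (T x) (T y) > 0"
    using tuple_metric_nonneg[OF D, of "G x" "G y"] by linarith
  from Meir_Keeler[OF this] obtain \<delta> where "\<delta> > 0"
    "D (G x) (G y) < D (T x) (T y) + \<delta> \<Longrightarrow> D (T x) (T y) < D (T x) (T y)"
    using assms by blast
  then show False using less by linarith
qed

lemma iteration_exists:
  obtains X where "X 0 = x0" "\<And>m. G (X (Suc m)) = T (X m)"
proof
  \<comment> \<open>Componentwise preimages under \<open>g\<close> exist because
    \<open>range F \<subseteq> range g\<close>.\<close>
  define X where "X m = ((\<lambda>x. \<chi> i. inv g (F (star_tuple star x i))) ^^ m) x0" for m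
  show "X 0 = x0" by (simp add: X_def)
  show "G (X (Suc m)) = T (X m)" for m
    using range_F by (auto simp: X_def vec_eq_iff intro!: f_inv_into_f)
qed

text \<open>Since \<open>T x = G x\<close>, monotonicity of \<open>T\<close> carries comparability
  with \<open>G x\<close> from each iterate to the next, so the Meir-Keeler condition applies to the
  distances to \<open>G x\<close> at every step.\<close>

lemma iteration_tendsto_coincidence:
  assumes X: "\<And>m. G (X (Suc m)) = T (X m)"
    and comparable: "mixed_comparable A B (G (X 0)) (G x)"
    and x: "T x = G x"
  shows "(\<lambda>m. G (X m) $ i) \<longlonglongrightarrow> G x $ i"
proof -
  have comparable: "mixed_comparable A B (G (X m)) (G x)" for m
  proof (induction m)
    case (Suc m)
    then show ?case using T_comparable[OF Suc] by (simp add: X x)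
  qed (fact comparable)
  have "(\<lambda>m. D (G (X m)) (G x)) \<longlonglongrightarrow> 0"
  proof (rule Meir_Keeler_tendsto_0[OF tuple_metric_nonneg[OF D]])
    fix \<epsilon> :: real assume "\<epsilon> > 0"
    from Meir_Keeler[OF this] show
      "\<exists>\<delta>>0. \<forall>m. D (G (X m)) (G x) < \<epsilon> + \<delta> \<longrightarrow> D (G (X (Suc m))) (G x) < \<epsilon>"
      using comparable by (metis X x)
  qed
  then show ?thesis by (rule tuple_metric_tendsto_componentI[OF D])
qed

lemma coincidence_unique:
  assumes "T x = G x" "T y = G y"
    and "mixed_comparable A B (G z) (G x)" "mixed_comparable A B (G z) (G y)"
  shows "G x = G y"
proof -
  obtain X where X: "X 0 = z" "\<And>m. G (X (Suc m)) = T (X m)"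
    using iteration_exists[of z] by blast
  have "G x $ i = G y $ i" for i
    using assms X
    by (intro LIMSEQ_unique[OF iteration_tendsto_coincidence[of X x] iteration_tendsto_coincidence[of X y]])
      auto
  then show ?thesis by (simp add: vec_eq_iff)
qed

lemma iteration_chain:
  assumes X: "\<And>m. G (X (Suc m)) = T (X m)"
    and "mixed_comparable A B (G (X 0)) (G (X 1))"
  shows "(\<forall>m. mixed_le A B (G (X m)) (G (X (Suc m)))) \<or> (\<forall>m. mixed_le A B (G (X (Suc m))) (G (X m)))"
proof -
  have "mixed_le A B (G (X m)) (G (X (Suc m)))" if "mixed_le A B (G (X 0)) (G (X 1))" for m
    using that
  proof (induction m)
    case (Suc m)
    then show ?case using T_mono[OF Suc.IH] by (simp add: X)
  qed simp
  moreover have "mixed_le A B (G (X (Suc m))) (G (X m))" if "mixed_le A B (G (X 1)) (G (X 0))" for m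
    using that
  proof (induction m)
    case (Suc m)
    then show ?case using T_mono[OF Suc.IH] by (simp add: X)
  qed simp
  ultimately show ?thesis using assms(2) unfolding mixed_comparable_def by blast
qed

lemma iteration_Cauchy:
  assumes X: "\<And>m. G (X (Suc m)) = T (X m)"
    and comparable: "\<And>m l. m \<le> l \<Longrightarrow> mixed_comparable A B (G (X m)) (G (X l))"
  shows "Cauchy (\<lambda>m. G (X m) $ i)"
proof (rule tuple_metric_Cauchy_componentI[OF D], rule Meir_Keeler_Cauchy)
  fix \<epsilon> :: real assume "\<epsilon> > 0"
  from Meir_Keeler[OF this] show "\<exists>\<delta>>0. \<forall>m l. m \<le> l \<longrightarrow>
      D (G (X m)) (G (X l)) < \<epsilon> + \<delta> \<longrightarrow> D (G (X (Suc m))) (G (X (Suc l))) < \<epsilon>"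
    using comparable by (metis X)
qed (auto simp: tuple_metric_nonneg[OF D] tuple_metric_refl[OF D] tuple_metric_triangle[OF D])

text \<open>The coincidence point is the limit \<open>z\<close> of the iterates
  \<open>G (X m)\<close> themselves. Compatibility yields that \<open>T (a m)\<close> tends to
  \<open>G z\<close>; continuity of \<open>F\<close> or the MCB property identifies the same limit
  as \<open>T z\<close>.\<close>

lemma coincidence_exists:
  assumes complete: "O_complete E" and range_E: "range F \<subseteq> E"
    and compatible: "O_compatible star F g"
    and g_cont: "O_continuous g"
    and F_cont: "O_continuous_tuple F \<or> MCB g E"
    and x0: "mixed_comparable A B (G x0) (T x0)"
  shows "\<exists>x. T x = G x"
proof -
  obtain X where X: "X 0 = x0" "\<And>m. G (X (Suc m)) = T (X m)"
    using iteration_exists[of x0] by blast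
  define a where "a m = G (X m)" for m
  have a_Suc: "a (Suc m) = T (X m)" for m by (simp add: a_def X)
  \<comment> \<open>The initial term \<open>G x0\<close> may lie outside \<open>E\<close>, so
    completeness and the MCB property are applied to the shifted sequence.\<close>
  have a_E: "a (Suc m) $ i \<in> E" for m i using range_E by (auto simp: a_Suc)
  have chain: "(\<forall>m. mixed_le A B (a m) (a (Suc m))) \<or> (\<forall>m. mixed_le B A (a m) (a (Suc m)))"
    using iteration_chain[of X] x0 X unfolding a_def by (simp add: mixed_le_swap[of B A])
  then have chain: "(\<forall>i\<in>A. incseq (\<lambda>m. a m $ i)) \<and> (\<forall>i\<in>B. decseq (\<lambda>m. a m $ i)) \<or>
      (\<forall>i\<in>B. incseq (\<lambda>m. a m $ i)) \<and> (\<forall>i\<in>A. decseq (\<lambda>m. a m $ i))"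
    unfolding mixed_chain_iff .
  have mono: "monoseq (\<lambda>m. a m $ i)" for i
    using chain AB by (metis UNIV_I UnE incseq_imp_monoseq decseq_imp_monoseq)
  have mono_Suc: "monoseq (\<lambda>m. a (Suc m) $ i)" for i
    using mono[of i] by (auto simp: monoseq_def)
  have comparable: "mixed_comparable A B (a m) (a l)" if "m \<le> l" for m l
    using chain that unfolding mixed_comparable_def mixed_le_def
    by (auto dest: incseqD decseqD)
  have Cauchy: "Cauchy (\<lambda>m. a m $ i)" for i
    unfolding a_def by (rule iteration_Cauchy) (use X comparable in \<open>auto simp: a_def\<close>)
  have "\<exists>z\<in>E. (\<lambda>m. a (Suc m) $ i) \<longlonglongrightarrow> z" for i
    using complete a_E mono_Suc[of i] Cauchy_subseq_Cauchy[OF Cauchy[of i], of Suc]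
    unfolding O_complete_def by (simp add: o_def strict_mono_Suc_iff)
  then obtain z' where z': "\<And>i. z' i \<in> E" "\<And>i. (\<lambda>m. a (Suc m) $ i) \<longlonglongrightarrow> z' i" by metis
  define z where "z = (\<chi> i. z' i)"
  have z_E: "z $ i \<in> E" and lim_Suc: "(\<lambda>m. a (Suc m) $ i) \<longlonglongrightarrow> z $ i" for i
    using z' by (auto simp: z_def)
  have lim: "(\<lambda>m. a m $ i) \<longlonglongrightarrow> z $ i" for i using lim_Suc by (rule LIMSEQ_imp_Suc)
  have a_mt: "mono_tendsto (\<lambda>m. a m $ i) (z $ i)" for i
    using mono lim by (simp add: mono_tendsto_def)
  have a_Suc_mt: "mono_tendsto (\<lambda>m. a (Suc m) $ i) (z $ i)" for i
    using mono_Suc lim_Suc by (simp add: mono_tendsto_def)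
  have G_lim: "(\<lambda>m. G (a m) $ i) \<longlonglongrightarrow> G z $ i" for i
    using g_cont a_mt[of i] by (simp add: O_continuous_def)
  \<comment> \<open>Compatibility is used for \<open>X\<close>: the values
    \<open>g (X m $ j)\<close> and \<open>F (star_tuple star (X m) j)\<close> are consecutive terms
    of one monotone sequence, hence share the limit \<open>z $ j\<close>.\<close>
  have "(\<lambda>m. dist (G (a (Suc m)) $ i) (T (a m) $ i)) \<longlonglongrightarrow> 0" for i
  proof -
    have "mono_tendsto (\<lambda>m. g (X m $ j)) (z $ j)"
      and "mono_tendsto (\<lambda>m. F (star_tuple star (X m) j)) (z $ j)" for j
      using a_mt[of j] a_Suc_mt[of j] by (simp_all add: a_def X)
    then have "(\<lambda>m. dist (g (F (star_tuple star (X m) i)))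
        (F (map_tuple g (star_tuple star (X m) i)))) \<longlonglongrightarrow> 0"
      using compatible unfolding O_compatible_def by blast
    then show ?thesis by (simp add: a_def X map_tuple_star_tuple)
  qed
  then have T_lim: "(\<lambda>m. T (a m) $ i) \<longlonglongrightarrow> G z $ i" for i
    by (rule tendsto_dist_0_transform[OF LIMSEQ_Suc[OF G_lim]])
  have cont_case: "T z = G z" if "O_continuous_tuple F"
  proof -
    have "(\<lambda>m. T (a m) $ i) \<longlonglongrightarrow> T z $ i" for i
      using that a_mt by (simp add: O_continuous_tuple_def)
    from LIMSEQ_unique[OF this T_lim] show ?thesis by (simp add: vec_eq_iff)
  qed
  have MCB_case: "T z = G z" if MCB: "MCB g E"
  proof -
    have up: "g (a (Suc m) $ i) \<le> g (z $ i)" if "incseq (\<lambda>m. a m $ i)" for m i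
    proof -
      have "incseq (\<lambda>m. a (Suc m) $ i)" using that by (simp add: incseq_Suc_iff)
      then show ?thesis
        using MCB[unfolded MCB_def, rule_format, of "z $ i" "\<lambda>m. a (Suc m) $ i"] a_E z_E lim_Suc
        by blast
    qed
    have down: "g (z $ i) \<le> g (a (Suc m) $ i)" if "decseq (\<lambda>m. a m $ i)" for m i
    proof -
      have "decseq (\<lambda>m. a (Suc m) $ i)" using that by (simp add: decseq_Suc_iff)
      then show ?thesis
        using MCB[unfolded MCB_def, rule_format, of "z $ i" "\<lambda>m. a (Suc m) $ i"] a_E z_E lim_Suc
        by blast
    qed
    \<comment> \<open>Whichever way the chain runs, the components in \<open>A\<close> and in
      \<open>B\<close> move oppositely, so the bounds \<open>up\<close> and \<open>down\<close>
      combine to comparability with \<open>G z\<close>.\<close>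
    have "mixed_comparable A B (G (a (Suc m))) (G z)" for m
      using chain up down unfolding mixed_comparable_def mixed_le_def by auto
    then have le: "D (T (a (Suc m))) (T z) \<le> D (G (a (Suc m))) (G z)" for m
      by (rule T_nonexpansive)
    have "(\<lambda>m. D (G (a (Suc m))) (G z)) \<longlonglongrightarrow> 0"
      by (intro tuple_metric_tendstoI[OF D] LIMSEQ_Suc[OF G_lim])
    then have "(\<lambda>m. D (T (a (Suc m))) (T z)) \<longlonglongrightarrow> 0"
      by (rule tendsto_sandwich[OF _ _ tendsto_const, rotated 2])
        (auto intro!: always_eventually tuple_metric_nonneg[OF D] le)
    then have "(\<lambda>m. T (a (Suc m)) $ i) \<longlonglongrightarrow> T z $ i" for i
      by (rule tuple_metric_tendsto_componentI[OF D])
    from LIMSEQ_unique[OF this LIMSEQ_Suc[OF T_lim]] show ?thesis by (simp add: vec_eq_iff)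
  qed
  from F_cont cont_case MCB_case show ?thesis by blast
qed

end

section \<open>From the contraction conditions to the theorem\<close>

text \<open>
  \<open>\<phi> 0\<close> may be positive, so the contraction condition is void when \<open>G x = G y\<close>; injectivity of \<open>g\<close>
  covers that case.
\<close>

lemma Omega_contraction_Meir_Keeler:
  fixes F :: "('a::{metric_space, order}) ^ 'n::finite \<Rightarrow> 'a"
  assumes D: "tuple_metric D" and "inj g" and "\<phi> \<in> Omega"
    and contraction: "\<And>x y. mixed_comparable A B (map_tuple g x) (map_tuple g y) \<Longrightarrow>
      D (star_map star F x) (star_map star F y) \<le> \<phi> (D (map_tuple g x) (map_tuple g y))"
    and "\<epsilon> > 0"
  shows "\<exists>\<delta>>0. \<forall>x y. mixed_comparable A B (map_tuple g x) (map_tuple g y) \<longrightarrow>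
      D (map_tuple g x) (map_tuple g y) < \<epsilon> + \<delta> \<longrightarrow> D (star_map star F x) (star_map star F y) < \<epsilon>"
proof -
  obtain \<delta> where \<delta>: "\<delta> > 0" "\<And>r. 0 < r \<Longrightarrow> r < \<epsilon> + \<delta> \<Longrightarrow> \<phi> r < \<epsilon>"
    using Omega_Meir_Keeler \<open>\<phi> \<in> Omega\<close> \<open>\<epsilon> > 0\<close> by blast
  have "D (star_map star F x) (star_map star F y) < \<epsilon>"
    if comp: "mixed_comparable A B (map_tuple g x) (map_tuple g y)"
      and less: "D (map_tuple g x) (map_tuple g y) < \<epsilon> + \<delta>" for x y
  proof (cases "D (map_tuple g x) (map_tuple g y) = 0")
    case True
    then have "map_tuple g x = map_tuple g y" by (rule tuple_metric_eq_0[OF D])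
    then have "x = y" using \<open>inj g\<close> by (simp add: vec_eq_iff inj_eq)
    then show ?thesis using tuple_metric_refl[OF D] \<open>\<epsilon> > 0\<close> by simp
  next
    case False
    then have "D (map_tuple g x) (map_tuple g y) > 0"
      using tuple_metric_nonneg[OF D, of "map_tuple g x" "map_tuple g y"] by linarith
    then show ?thesis using \<delta>(2) less contraction[OF comp] by fastforce
  qed
  with \<delta>(1) show ?thesis by blast
qed

theorem theorem3:
  fixes A B :: "'n::finite set"
    and star :: "'n \<Rightarrow> 'n \<Rightarrow> 'n"
    and E :: "'a::{metric_space, order} set"
    and F :: "'a ^ 'n \<Rightarrow> 'a"
    and g :: "'a \<Rightarrow> 'a"
  assumes n_ge_2: "CARD('n) \<ge> 2"
    and partition: "index_partition A B"
    and star: "star \<in> mixed_ops A B"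
    and subspace: "E \<noteq> {}" and complete: "O_complete E"
    and i: "range F \<subseteq> range g \<inter> E"
    and ii: "mixed_monotone A B F g"
    and iii: "O_compatible star F g"
    and iv: "O_continuous g"
    and v: "O_continuous_tuple F \<or> MCB g E"
    and vi: "\<exists>x0 :: 'a ^ 'n.
          ((\<forall>i\<in>A. g (x0 $ i) \<le> F (star_tuple star x0 i)) \<and>
           (\<forall>i\<in>B. g (x0 $ i) \<ge> F (star_tuple star x0 i)))
        \<or> ((\<forall>i\<in>A. g (x0 $ i) \<ge> F (star_tuple star x0 i)) \<and>
           (\<forall>i\<in>B. g (x0 $ i) \<le> F (star_tuple star x0 i)))"
    and vii:
      "(\<exists>\<phi>\<in>Omega. \<forall>x y. mixed_comparable A B (map_tuple g x) (map_tuple g y) \<longrightarrow>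
          1 / real CARD('n) * (\<Sum>i\<in>UNIV. dist (F (star_tuple star x i)) (F (star_tuple star y i)))
            \<le> \<phi> (1 / real CARD('n) * (\<Sum>i\<in>UNIV. dist (g (x $ i)) (g (y $ i)))))
     \<or> (\<exists>\<phi>\<in>Omega. \<forall>x y. mixed_comparable A B (map_tuple g x) (map_tuple g y) \<longrightarrow>
          (MAX i\<in>UNIV. dist (F (star_tuple star x i)) (F (star_tuple star y i)))
            \<le> \<phi> (MAX i\<in>UNIV. dist (g (x $ i)) (g (y $ i))))"
    and connecting: "\<forall>x y :: 'a ^ 'n. \<exists>z :: 'a ^ 'n.
          mixed_comparable A B (map_tuple g z) (map_tuple g x) \<and>
          mixed_comparable A B (map_tuple g z) (map_tuple g y)"
    and one_one: "inj g"
  shows "\<exists>!x. coincidence_point star F g x"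
proof -
  have AB: "A \<union> B = UNIV" using partition by (simp add: index_partition_def)
  obtain D :: "'a ^ 'n \<Rightarrow> 'a ^ 'n \<Rightarrow> real" and \<phi> where D: "tuple_metric D" and \<phi>: "\<phi> \<in> Omega"
    and contraction: "\<And>x y. mixed_comparable A B (map_tuple g x) (map_tuple g y) \<Longrightarrow>
      D (star_map star F x) (star_map star F y) \<le> \<phi> (D (map_tuple g x) (map_tuple g y))"
    using vii
  proof (elim disjE bexE)
    fix \<phi> assume "\<phi> \<in> Omega" and "\<forall>x y. mixed_comparable A B (map_tuple g x) (map_tuple g y) \<longrightarrow>
          1 / real CARD('n) * (\<Sum>i\<in>UNIV. dist (F (star_tuple star x i)) (F (star_tuple star y i)))
            \<le> \<phi> (1 / real CARD('n) * (\<Sum>i\<in>UNIV. dist (g (x $ i)) (g (y $ i))))"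
    then show thesis by (intro that[OF tuple_metric_mean \<open>\<phi> \<in> Omega\<close>]) simp
  next
    fix \<phi> assume "\<phi> \<in> Omega" and "\<forall>x y. mixed_comparable A B (map_tuple g x) (map_tuple g y) \<longrightarrow>
          (MAX i\<in>UNIV. dist (F (star_tuple star x i)) (F (star_tuple star y i)))
            \<le> \<phi> (MAX i\<in>UNIV. dist (g (x $ i)) (g (y $ i)))"
    then show thesis by (intro that[OF tuple_metric_max \<open>\<phi> \<in> Omega\<close>]) simp
  qed
  interpret mixed_Meir_Keeler A B star F g D
    using AB star i ii D Omega_contraction_Meir_Keeler[OF D one_one \<phi> contraction]
    by unfold_locales auto
  \<comment> \<open>The two alternatives for the initial tuple are the two directions of
    comparability between \<open>G x0\<close> and \<open>T x0\<close>.\<close>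
  from vi obtain x0 where "mixed_comparable A B (G x0) (T x0)"
    by (auto simp: mixed_comparable_def mixed_le_def)
  then have "\<exists>x. T x = G x"
    using i by (intro coincidence_exists[OF complete _ iii iv v]) auto
  moreover have "x = y" if "T x = G x" "T y = G y" for x y
  proof -
    have "G x = G y" using connecting coincidence_unique[OF that] by blast
    then show "x = y" using one_one by (simp add: vec_eq_iff inj_eq)
  qed
  ultimately show ?thesis unfolding coincidence_point_iff by blast
qed

end
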